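(* Let $E$ be an absolutely algebraic field of characteristic $p$ and $T=FG(E)$. Then every proper subring of $E$ can be embedded in a maximal one (i.e. is contained in some maximal subring of $E$) if and only if $T_\infty=\emptyset$, i.e. every prime in $T$ has finite order in $T$ (equivalently, $L(E)=\mathbb{F}_p$).
   Context: All rings are commutative with $1\neq 0$ and subrings are unital. A proper subring $S$ of a ring $R$ is a maximal subring of $R$ if it is maximal with respect to inclusion among all proper subrings of $R$. An absolutely algebraic field of characteristic $p$ is a field algebraic over $\mathbb{F}_p$, $p$ prime; regard it as a subfield of a fixed algebraic closure $\bar{\mathbb{F}}_p$. Let $\mathbb{N}$ be the positive integers and $FG(E)=\{n\in\mathbb{N}:\mathbb{F}_{p^n}\subseteq E\}$. For $T=FG(E)$, $T_\infty$ is the set of primes $q$ such that $q^n\in T$ for all $n\in\mathbb{N}$; an element $t\in T$ has finite order in $T$ if there is $n\in\mathbb{N}$ with $t^n\in T$ and $t^{n+1}\notin T$. $L(E)$ denotes the subfield $\bigcup_{n\in T'}\mathbb{F}_{p^n}$ of $E$, where $T'$ is the set of all positive integers all of whose prime divisors lie in $T_\infty$ (so $1\in T'$). *)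

theory Defs
  imports "HOL-Algebra.Algebraic_Closure" "HOL-Computational_Algebra.Primes"
begin

definition maximal_subring :: "'a set \<Rightarrow> ('a, 'b) ring_scheme \<Rightarrow> bool" where
  "maximal_subring M R \<longleftrightarrow>
     subring M R \<and> M \<noteq> carrier R \<and>
     (\<forall>S. subring S R \<and> S \<noteq> carrier R \<and> M \<subseteq> S \<longrightarrow> S = M)"

text \<open>
  The finite field of order \<open>q\<close> inside \<open>\<Omega>\<close>. The description is proper when \<open>\<Omega>\<close> is an
  algebraic closure of a field of prime order \<open>p\<close> and \<open>q = p ^ n\<close> with \<open>n > 0\<close>;
  it is only used in this situation.
\<close>
definition GF :: "('a, 'b) ring_scheme \<Rightarrow> nat \<Rightarrow> 'a set" where
  "GF \<Omega> q = (THE F. subfield F \<Omega> \<and> card F = q)"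

definition FG :: "('a, 'b) ring_scheme \<Rightarrow> nat \<Rightarrow> 'a set \<Rightarrow> nat set" where
  "FG \<Omega> p E = {n. n > 0 \<and> GF \<Omega> (p ^ n) \<subseteq> E}"

definition infinite_primes :: "nat set \<Rightarrow> nat set" where
  "infinite_primes T = {q. Factorial_Ring.prime q \<and> (\<forall>n>0. q ^ n \<in> T)}"

definition has_finite_order_in :: "nat \<Rightarrow> nat set \<Rightarrow> bool" where
  "has_finite_order_in t T \<longleftrightarrow> (\<exists>n>0. t ^ n \<in> T \<and> t ^ (n + 1) \<notin> T)"

text \<open>The subfield usually written \<open>L(E)\<close>; the index set contains \<open>1\<close>.\<close>
definition infinite_part :: "('a, 'b) ring_scheme \<Rightarrow> nat \<Rightarrow> 'a set \<Rightarrow> 'a set" where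
  "infinite_part \<Omega> p E =
     (\<Union>n \<in> {n. n > 0 \<and>
        (\<forall>q. Factorial_Ring.prime q \<and> q dvd n \<longrightarrow> q \<in> infinite_primes (FG \<Omega> p E))}.
        GF \<Omega> (p ^ n))"

end

theory Submission
  imports Defs "HOL-Algebra.Sylow"
begin

text \<open>
  Write \<open>K n\<close> for the field of order \<open>p ^ n\<close> in the algebraic closure; it is realised as the set
  \<open>fixed n\<close> of fixed points of the \<open>n\<close>-th power of the Frobenius map. The whole argument rests on
  one fact, \<open>subring_inter_fixed\<close>: the intersection of an arbitrary subring with \<open>K n\<close> is \<open>K m\<close> for
  some divisor \<open>m\<close> of \<open>n\<close>. Every element of the closure lies in some \<open>K n\<close>, so a subring is known
  once it is known which \<open>K n\<close> it contains, and because an intersection of two subfields \<open>K m\<close> is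
  governed by the gcd of the indices, only the prime power indices matter.

  Fix a prime \<open>q\<close> and \<open>k > 0\<close>. The elements whose degree over the prime field is not divisible
  by \<open>q ^ k\<close> form a subring, \<open>avoiding q k\<close>, and every subring that does not contain \<open>K (q ^ k)\<close>
  lies inside it.

  Suppose that every prime has bounded exponent in \<open>T\<close>, and let \<open>S\<close> be a proper subring of \<open>E\<close>.
  Some \<open>K (q ^ j)\<close> is contained in \<open>E\<close> but not in \<open>S\<close>. If \<open>q ^ k\<close> is the largest power of \<open>q\<close> in \<open>T\<close>,
  then \<open>S\<close> lies in \<open>E \<inter> avoiding q k\<close>, and this subring is maximal: a strictly larger one contains
  \<open>K (q ^ k)\<close>, hence all the \<open>q\<close>-power fields of \<open>E\<close>, while it already had the ones for the other
  primes.

  Conversely, let all powers of \<open>q\<close> lie in \<open>T\<close>. Then \<open>E \<inter> avoiding q 1\<close> is a proper subring that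
  is contained in no maximal one. A proper subring \<open>M\<close> above it misses some \<open>K (q ^ k)\<close>; for the
  least such \<open>k\<close> it lies in \<open>E \<inter> avoiding q k\<close>, which is strictly smaller than
  \<open>E \<inter> avoiding q (Suc k)\<close>, and the latter is still proper.
\<close>

section \<open>The Frobenius map in characteristic p\<close>

lemma (in cring) binomial_formula:
  fixes n :: nat
  assumes x: "x \<in> carrier R" and y: "y \<in> carrier R"
  shows "(x \<oplus> y) [^] n = (\<Oplus>i\<in>{..n}. [(n choose i)] \<cdot> (x [^] i \<otimes> y [^] (n - i)))"
proof (induction n)
  case 0
  show ?case using x y by simp
next
  case (Suc n)
  let ?b = "\<lambda>i. [(n choose i)] \<cdot> (x [^] i \<otimes> y [^] (n - i))"
  let ?u = "\<lambda>i. [(n choose i)] \<cdot> (x [^] Suc i \<otimes> y [^] (n - i))"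
  let ?v = "\<lambda>i. [(n choose i)] \<cdot> (x [^] i \<otimes> y [^] (Suc n - i))"
  let ?c = "\<lambda>i. [(Suc n choose i)] \<cdot> (x [^] i \<otimes> y [^] (Suc n - i))"
  have ux: "?b i \<otimes> x = ?u i" for i
    using x y by (subst add_pow_ldistr) (simp_all add: m_ac)
  have vy: "?b i \<otimes> y = ?v i" if "i \<in> {..n}" for i
    using x y that by (subst add_pow_ldistr) (simp_all add: m_ac Suc_diff_le)
  have c_split: "?c (Suc i) = ?u i \<oplus> ?v (Suc i)" for i
    using x y by (simp add: add.nat_pow_mult)
  have v_top: "?v (Suc n) = \<zero>"
    using x y by (simp add: binomial_eq_0)
  \<comment> \<open>Pascal's rule splits the coefficients of exponent \<open>Suc n\<close> into two sums. The second one,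
    completed by its term at index \<open>0\<close>, is the sum obtained by multiplying with \<open>y\<close>, because the
    added top term vanishes.\<close>
  have v_shift: "(\<Oplus>i\<in>{..n}. ?v i) = (\<Oplus>i\<in>{..n}. ?v (Suc i)) \<oplus> ?v 0"
  proof -
    have "(\<Oplus>i\<in>{..n}. ?v i) = (\<Oplus>i\<in>{..Suc n}. ?v i)"
      using x y finsum_Suc[of ?v n] v_top by (simp add: Pi_def)
    also have "\<dots> = (\<Oplus>i\<in>{..n}. ?v (Suc i)) \<oplus> ?v 0"
      using x y by (intro finsum_Suc2) (auto simp: Pi_def)
    finally show ?thesis .
  qed
  have "(x \<oplus> y) [^] Suc n = (\<Oplus>i\<in>{..n}. ?b i) \<otimes> (x \<oplus> y)"
    using Suc by simp
  also have "\<dots> = (\<Oplus>i\<in>{..n}. ?b i) \<otimes> x \<oplus> (\<Oplus>i\<in>{..n}. ?b i) \<otimes> y"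
    using x y by (intro r_distr finsum_closed) (auto simp: Pi_def)
  also have "(\<Oplus>i\<in>{..n}. ?b i) \<otimes> x = (\<Oplus>i\<in>{..n}. ?b i \<otimes> x)"
    using x y by (intro finsum_ldistr) (auto simp: Pi_def)
  also have "\<dots> = (\<Oplus>i\<in>{..n}. ?u i)"
    using x y by (intro finsum_cong' refl ux) (auto simp: Pi_def)
  also have "(\<Oplus>i\<in>{..n}. ?b i) \<otimes> y = (\<Oplus>i\<in>{..n}. ?b i \<otimes> y)"
    using x y by (intro finsum_ldistr) (auto simp: Pi_def)
  also have "\<dots> = (\<Oplus>i\<in>{..n}. ?v i)"
    using x y by (intro finsum_cong' refl vy) (auto simp: Pi_def)
  also have "(\<Oplus>i\<in>{..n}. ?u i) \<oplus> (\<Oplus>i\<in>{..n}. ?v i)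
           = ((\<Oplus>i\<in>{..n}. ?u i) \<oplus> (\<Oplus>i\<in>{..n}. ?v (Suc i))) \<oplus> ?v 0"
    unfolding v_shift using x y
    by (intro add.m_assoc[symmetric] finsum_closed) (auto simp: Pi_def)
  also have "(\<Oplus>i\<in>{..n}. ?u i) \<oplus> (\<Oplus>i\<in>{..n}. ?v (Suc i)) = (\<Oplus>i\<in>{..n}. ?u i \<oplus> ?v (Suc i))"
    using x y by (intro finsum_addf[symmetric]) (auto simp: Pi_def)
  also have "\<dots> = (\<Oplus>i\<in>{..n}. ?c (Suc i))"
    unfolding c_split ..
  also have "\<dots> \<oplus> ?v 0 = (\<Oplus>i\<in>{..n}. ?c (Suc i)) \<oplus> ?c 0"
    by simp
  also have "\<dots> = (\<Oplus>i\<in>{..Suc n}. ?c i)"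
    using x y by (intro finsum_Suc2[symmetric]) (auto simp: Pi_def)
  finally show ?case .
qed

lemma (in ring) add_pow_eq_zero_of_dvd:
  fixes p k :: nat
  assumes "[p] \<cdot> \<one> = \<zero>" and "p dvd k" and x: "x \<in> carrier R"
  shows "[k] \<cdot> x = \<zero>"
proof -
  obtain j where j: "k = p * j" using assms(2) by auto
  have "[p] \<cdot> x = ([p] \<cdot> \<one>) \<otimes> x" using x by (simp add: add_pow_ldistr)
  then have "[p] \<cdot> x = \<zero>" using assms(1) x by simp
  moreover have "[k] \<cdot> x = [j] \<cdot> ([p] \<cdot> x)" unfolding j using x by (simp add: add.nat_pow_pow)
  ultimately show ?thesis by simp
qed

text \<open>
  The binomial coefficients strictly between the two ends are divisible by \<open>p\<close>, so only the two
  outer terms of the binomial formula survive.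
\<close>
lemma (in cring) frobenius_add:
  fixes p :: nat
  assumes p: "Factorial_Ring.prime p" and char: "[p] \<cdot> \<one> = \<zero>"
    and x: "x \<in> carrier R" and y: "y \<in> carrier R"
  shows "(x \<oplus> y) [^] p = x [^] p \<oplus> y [^] p"
proof -
  let ?c = "\<lambda>i. [(p choose i)] \<cdot> (x [^] i \<otimes> y [^] (p - i))"
  obtain m where m: "p = Suc (Suc m)"
    using prime_ge_2_nat[OF p] by (metis add_2_eq_Suc le_Suc_ex)
  have mid: "?c (Suc i) = \<zero>" if "i \<le> m" for i
  proof (rule add_pow_eq_zero_of_dvd[OF char])
    show "p dvd p choose Suc i"
      using that m by (intro dvd_choose_prime p) auto
  qed (use x y in auto)
  have "(x \<oplus> y) [^] p = (\<Oplus>i\<in>{..Suc (Suc m)}. ?c i)"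
    using binomial_formula[OF x y, of p] m by simp
  also have "\<dots> = ?c (Suc (Suc m)) \<oplus> (\<Oplus>i\<in>{..Suc m}. ?c i)"
    using x y by (intro finsum_Suc) (auto simp: Pi_def)
  also have "(\<Oplus>i\<in>{..Suc m}. ?c i) = (\<Oplus>i\<in>{..m}. ?c (Suc i)) \<oplus> ?c 0"
    using x y by (intro finsum_Suc2) (auto simp: Pi_def)
  also have "(\<Oplus>i\<in>{..m}. ?c (Suc i)) = (\<Oplus>i\<in>{..m}. \<zero>)"
    using mid by (intro finsum_cong') auto
  finally show ?thesis using x y m by simp
qed

lemma (in cring) frobenius_power_add:
  fixes p :: nat
  assumes p: "Factorial_Ring.prime p" and char: "[p] \<cdot> \<one> = \<zero>"
    and x: "x \<in> carrier R" and y: "y \<in> carrier R"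
  shows "(x \<oplus> y) [^] (p ^ n) = x [^] (p ^ n) \<oplus> y [^] (p ^ n)"
proof (induction n)
  case (Suc n)
  have "(x \<oplus> y) [^] (p ^ Suc n) = ((x \<oplus> y) [^] (p ^ n)) [^] p"
    using x y by (simp add: nat_pow_pow mult.commute[of p])
  also have "\<dots> = (x [^] (p ^ n)) [^] p \<oplus> (y [^] (p ^ n)) [^] p"
    unfolding Suc using x y by (intro frobenius_add p char) auto
  finally show ?case using x y by (simp add: nat_pow_pow mult.commute[of p])
qed (use x y in simp)

section \<open>Counting the fixed points of a power of Frobenius\<close>

lemma (in ring_hom_ring) hom_add_nat_pow:
  fixes k :: nat
  assumes "x \<in> carrier R"
  shows "h ([k] \<cdot>\<^bsub>R\<^esub> x) = [k] \<cdot>\<^bsub>S\<^esub> h x"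
  using assms by (induction k) auto

lemma (in domain) poly_ring_char:
  fixes p :: nat
  assumes "[p] \<cdot> \<one> = \<zero>"
  shows "[p] \<cdot>\<^bsub>poly_ring R\<^esub> \<one>\<^bsub>poly_ring R\<^esub> = \<zero>\<^bsub>poly_ring R\<^esub>"
proof -
  interpret C: ring_hom_ring R "poly_ring R" poly_of_const
    using canonical_embedding_ring_hom[OF carrier_is_subring] by simp
  show ?thesis
    using C.hom_add_nat_pow[of \<one> p] assms by simp
qed

text \<open>
  The polynomial \<open>X ^ q - X\<close>, whose roots in an algebraically closed field of characteristic \<open>p\<close>
  form the field of order \<open>q\<close> when \<open>q = p ^ n\<close> with \<open>n > 0\<close>.
\<close>
definition (in ring) frobenius_poly :: "nat \<Rightarrow> 'a list" where
  "frobenius_poly q = X [^]\<^bsub>poly_ring R\<^esub> q \<ominus>\<^bsub>poly_ring R\<^esub> X"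

context field
begin

lemma frobenius_poly_closed: "frobenius_poly q \<in> carrier (poly_ring R)"
proof -
  interpret UP: domain "poly_ring R"
    using univ_poly_is_domain[OF carrier_is_subring] .
  show ?thesis
    unfolding frobenius_poly_def using var_closed(1)[OF carrier_is_subring] by auto
qed

lemma degree_frobenius_poly:
  assumes "q > 1"
  shows "degree (frobenius_poly q) = q"
proof -
  interpret UP: domain "poly_ring R"
    using univ_poly_is_domain[OF carrier_is_subring] .
  note X = var_closed(1)[OF carrier_is_subring]
  have dX: "degree X = 1" by (simp add: var_def)
  have dq: "degree (X [^]\<^bsub>poly_ring R\<^esub> q) = q"
    using polynomial_pow_degree[OF X] dX by simp
  have dm: "degree (\<ominus>\<^bsub>poly_ring R\<^esub> X) = 1"
    using univ_poly_a_inv_degree[OF carrier_is_subring X] dX by simp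
  have "polynomial (carrier R) (X [^]\<^bsub>poly_ring R\<^esub> q)"
    "polynomial (carrier R) (\<ominus>\<^bsub>poly_ring R\<^esub> X)"
    using X by (simp_all add: univ_poly_carrier)
  from poly_add_degree_eq[OF carrier_is_subring this]
  show ?thesis
    using assms dq dm unfolding frobenius_poly_def a_minus_def univ_poly_add by simp
qed

lemma is_root_frobenius_poly_iff:
  assumes "q > 1"
  shows "is_root (frobenius_poly q) a \<longleftrightarrow> a \<in> carrier R \<and> a [^] q = a"
proof (cases "a \<in> carrier R")
  case a: True
  interpret UP: domain "poly_ring R"
    using univ_poly_is_domain[OF carrier_is_subring] .
  interpret ev: ring_hom_ring "poly_ring R" R "\<lambda>p. eval p a"
    using eval_ring_hom[OF carrier_is_subring a] .
  note X = var_closed(1)[OF carrier_is_subring]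
  have "eval (frobenius_poly q) a = a [^] q \<ominus> a"
    unfolding frobenius_poly_def a_minus_def using X a
    by (simp add: ev.hom_nat_pow eval_var)
  moreover have "frobenius_poly q \<noteq> []"
    using degree_frobenius_poly[OF assms] assms by auto
  ultimately show ?thesis
    using a by (simp add: is_root_def)
qed (simp add: is_root_def)

text \<open>
  Separability without derivatives. Let \<open>f = X ^ q - X\<close> and let \<open>a\<close> be a root. Since the Frobenius
  map is additive on polynomials and fixes the constant \<open>a\<close>, the polynomial \<open>g = X - a\<close> satisfies
  \<open>f = g ^ q - g\<close>. If \<open>g ^ 2\<close> divided \<open>f\<close> it would divide \<open>g\<close>, which is impossible for degree
  reasons.
\<close>
lemma alg_mult_frobenius_poly_le_1:
  fixes p :: nat
  assumes p: "Factorial_Ring.prime p" and char: "[p] \<cdot> \<one> = \<zero>" and n: "n > 0"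
    and root: "is_root (frobenius_poly (p ^ n)) a"
  shows "alg_mult (frobenius_poly (p ^ n)) a \<le> 1"
proof (rule ccontr)
  let ?P = "poly_ring R" and ?q = "p ^ n"
  let ?f = "frobenius_poly ?q" and ?g = "[\<one>, \<ominus> a]" and ?c = "poly_of_const a"
  interpret UP: domain ?P
    using univ_poly_is_domain[OF carrier_is_subring] .
  interpret C: ring_hom_ring R ?P poly_of_const
    using canonical_embedding_ring_hom[OF carrier_is_subring] by simp
  note X = var_closed(1)[OF carrier_is_subring]
  have q1: "?q > 1" using prime_gt_1_nat[OF p] n by (rule one_less_power)
  have a: "a \<in> carrier R" and aq: "a [^] ?q = a"
    using root is_root_frobenius_poly_iff[OF q1] by auto
  have g: "?g \<in> carrier ?P"
    using a unfolding sym[OF univ_poly_carrier] polynomial_def by auto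
  have c: "?c \<in> carrier ?P" using a by simp
  have cq: "?c [^]\<^bsub>?P\<^esub> ?q = ?c"
    using C.hom_nat_pow[OF a, of ?q] aq by simp
  have Xg: "X = ?g \<oplus>\<^bsub>?P\<^esub> ?c"
    using a by (auto simp: var_def univ_poly_add poly_of_const_def l_neg)
  have "X [^]\<^bsub>?P\<^esub> ?q = ?g [^]\<^bsub>?P\<^esub> ?q \<oplus>\<^bsub>?P\<^esub> ?c"
    unfolding Xg using UP.frobenius_power_add[OF p poly_ring_char[OF char] g c] cq by simp
  then have f_eq: "?f = ?g [^]\<^bsub>?P\<^esub> ?q \<ominus>\<^bsub>?P\<^esub> ?g"
    unfolding frobenius_poly_def Xg using g c UP.nat_pow_closed[OF g, of ?q]
    by (simp add: UP.minus_add a_minus_def UP.a_ac UP.r_neg UP.r_neg1 UP.r_neg2)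
  assume "\<not> alg_mult ?f a \<le> 1"
  then have "?g [^]\<^bsub>?P\<^esub> (2::nat) pdivides ?f"
    by (intro le_alg_mult_imp_pdivides a frobenius_poly_closed) auto
  moreover have "?g [^]\<^bsub>?P\<^esub> (2::nat) pdivides ?g [^]\<^bsub>?P\<^esub> ?q"
    using q1 by (intro polynomial_pow_division g) auto
  ultimately obtain u v where u: "u \<in> carrier ?P" "?f = ?g [^]\<^bsub>?P\<^esub> (2::nat) \<otimes>\<^bsub>?P\<^esub> u"
    and v: "v \<in> carrier ?P" "?g [^]\<^bsub>?P\<^esub> ?q = ?g [^]\<^bsub>?P\<^esub> (2::nat) \<otimes>\<^bsub>?P\<^esub> v"
    unfolding pdivides_def factor_def by auto
  have "?g [^]\<^bsub>?P\<^esub> ?q \<ominus>\<^bsub>?P\<^esub> ?f = ?g [^]\<^bsub>?P\<^esub> (2::nat) \<otimes>\<^bsub>?P\<^esub> (v \<ominus>\<^bsub>?P\<^esub> u)"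
    unfolding u(2) v(2) using u(1) v(1) UP.nat_pow_closed[OF g, of 2]
    by (simp add: a_minus_def UP.r_distr UP.r_minus)
  then have "?g [^]\<^bsub>?P\<^esub> (2::nat) divides\<^bsub>?P\<^esub> (?g [^]\<^bsub>?P\<^esub> ?q \<ominus>\<^bsub>?P\<^esub> ?f)"
    unfolding factor_def using u(1) v(1) by blast
  moreover have "?g [^]\<^bsub>?P\<^esub> ?q \<ominus>\<^bsub>?P\<^esub> ?f = ?g"
    unfolding f_eq using g UP.nat_pow_closed[OF g, of ?q]
    by (simp add: UP.minus_add a_minus_def UP.a_ac UP.r_neg UP.r_neg1 UP.r_neg2)
  ultimately have "?g [^]\<^bsub>?P\<^esub> (2::nat) pdivides ?g" unfolding pdivides_def by simp
  from pdivides_imp_degree_le[OF carrier_is_subring _ g _ this] g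
  have "degree (?g [^]\<^bsub>?P\<^esub> (2::nat)) \<le> degree ?g" by simp
  then show False using polynomial_pow_degree[OF g, of 2] by simp
qed

end

text \<open>
  Over an algebraically closed field a polynomial of degree \<open>p ^ n\<close> has that many roots counted with
  multiplicity, and here all multiplicities are one.
\<close>
lemma (in algebraically_closed) card_frobenius_fixed:
  fixes p :: nat
  assumes p: "Factorial_Ring.prime p" and char: "[p] \<cdot> \<one> = \<zero>" and n: "n > 0"
  shows "card {x \<in> carrier L. x [^] (p ^ n) = x} = p ^ n"
proof -
  let ?f = "frobenius_poly (p ^ n)"
  have q1: "p ^ n > 1" using prime_gt_1_nat[OF p] n by (rule one_less_power)
  have roots: "set_mset (roots ?f) = {x \<in> carrier L. x [^] (p ^ n) = x}"
    using roots_mem_iff_is_root[OF frobenius_poly_closed] is_root_frobenius_poly_iff[OF q1] by auto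
  have "count (roots ?f) x = 1" if "x \<in># roots ?f" for x
  proof -
    have "is_root ?f x" using that roots_mem_iff_is_root[OF frobenius_poly_closed] by simp
    then have "alg_mult ?f x \<le> 1"
      by (rule alg_mult_frobenius_poly_le_1[OF p char n])
    then show ?thesis
      using that alg_mult_eq_count_roots[OF frobenius_poly_closed]
      by (simp add: le_antisym)
  qed
  then have "size (roots ?f) = card (set_mset (roots ?f))"
    by (simp add: size_multiset_overloaded_eq)
  moreover have "size (roots ?f) = p ^ n"
    using roots_over_carrier[OF frobenius_poly_closed, of "p ^ n"] degree_frobenius_poly[OF q1]
    by (simp add: splitted_def)
  ultimately show ?thesis using roots by simp
qed

section \<open>Finite subrings of a field\<close>

text \<open>
  If another prime \<open>q\<close> divided the order, a subgroup of order \<open>q\<close> (supplied by Sylow) would contain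
  an element whose order divides both \<open>p\<close> and \<open>q\<close> without being one.
\<close>
lemma (in group) order_prime_power_if_exponent_prime:
  fixes p :: nat
  assumes fin: "finite (carrier G)" and p: "Factorial_Ring.prime p"
    and expo: "\<And>x. x \<in> carrier G \<Longrightarrow> x [^] p = \<one>"
  shows "\<exists>m. order G = p ^ m"
proof -
  have pos: "order G > 0" using fin by (simp add: order_gt_0_iff_finite)
  have only_p: "q = p" if q: "Factorial_Ring.prime q" "q dvd order G" for q
  proof -
    obtain k where "order G = q ^ 1 * k" using q(2) by auto
    then obtain H where H: "subgroup H G" "card H = q"
      using sylow_thm[OF q(1) is_group _ fin, of 1 k] by auto
    then have "card H \<ge> 2" using prime_ge_2_nat[OF q(1)] by simp
    then have "\<not> H \<subseteq> {\<one>}" using card_mono[of "{\<one>}" H] by auto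
    then obtain x where x: "x \<in> H" "x \<noteq> \<one>" by blast
    have xG: "x \<in> carrier G" using H(1) x(1) by (rule subgroup.mem_carrier)
    interpret H: group "G\<lparr>carrier := H\<rparr>"
      using H(1) is_group by (rule subgroup.subgroup_is_group)
    have "x [^]\<^bsub>G\<lparr>carrier := H\<rparr>\<^esub> order (G\<lparr>carrier := H\<rparr>) = \<one>\<^bsub>G\<lparr>carrier := H\<rparr>\<^esub>"
      using x(1) by (intro H.pow_order_eq_1) simp
    then have "x [^] q = \<one>"
      using nat_pow_consistent[of x q H] H(2) by (simp add: order_def)
    then have "ord x dvd q" using pow_eq_id[OF xG] by simp
    moreover have "ord x dvd p" using pow_eq_id[OF xG] expo[OF xG] by simp
    moreover have "ord x \<noteq> 1" using ord_eq_1[OF xG] x(2) by simp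
    ultimately show "q = p"
      using q(1) p by (metis prime_nat_iff)
  qed
  obtain k where k: "order G = p ^ multiplicity p (order G) * k" "\<not> p dvd k"
    using multiplicity_decompose'[of "order G" p] pos prime_gt_1_nat[OF p] by auto
  have "k = 1"
  proof (rule ccontr)
    assume "k \<noteq> 1"
    then obtain q where q: "Factorial_Ring.prime q" "q dvd k"
      using prime_factor_nat by blast
    then have "q dvd order G" by (subst k(1)) simp
    then show False using only_p[OF q(1)] q(2) k(2) by simp
  qed
  then show ?thesis using k(1) by auto
qed

text \<open>
  Two powers of a nonzero element of a finite subring coincide, so some positive power of it is one,
  and its inverse is again a power of it.
\<close>
lemma (in field) finite_subring_is_subfield:
  assumes S: "subring S R" and fin: "finite S"
  shows "subfield S R"
proof (rule subfieldI'[OF S])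
  fix x assume x: "x \<in> S - {\<zero>}"
  have xR: "x \<in> carrier R" using x subringE(1)[OF S] by auto
  have pow: "x [^] (i::nat) \<in> S" for i
    using x subringE(3,6)[OF S] by (induction i) auto
  have "\<not> inj (\<lambda>i::nat. x [^] i)"
    using finite_subset[of "range (\<lambda>i::nat. x [^] i)" S] pow fin
    by (metis finite_imageD image_subsetI infinite_UNIV_nat)
  then obtain i j :: nat where ij: "i < j" "x [^] i = x [^] j"
    by (auto simp: inj_on_def) (metis linorder_neqE_nat)
  obtain d where d: "j = i + Suc d" using ij(1) less_iff_Suc_add by auto
  have "x [^] i \<otimes> x [^] Suc d = x [^] i \<otimes> \<one>"
    using ij(2) d xR nat_pow_mult[OF xR, of i "Suc d"] by simp
  moreover have "x [^] i \<noteq> \<zero>"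
    using xR x by (induction i) (auto simp: integral_iff)
  ultimately have "x [^] Suc d = \<one>"
    using m_lcancel[of "x [^] i" "x [^] Suc d" \<one>] xR by simp
  then have "x [^] d \<otimes> x = \<one>" "x \<otimes> x [^] d = \<one>"
    using xR by (simp_all add: m_comm)
  then have "inv x = x [^] d"
    using xR by (intro comm_inv_char) auto
  then show "inv x \<in> S" using pow by simp
qed

text \<open>
  Lagrange's theorem for the multiplicative group of the subring, which is a field.
\<close>
lemma (in field) finite_subring_pow_card:
  assumes S: "subring S R" and fin: "finite S" and x: "x \<in> S"
  shows "x [^] card S = x"
proof -
  have zero: "\<zero> \<in> S" by (rule subringE(2)[OF S])
  have F: "subfield S R" by (rule finite_subring_is_subfield[OF S fin])
  have pos: "card S > 0" using fin zero by (metis card_gt_0_iff empty_iff)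
  have xR: "x \<in> carrier R" using x subringE(1)[OF S] by auto
  show ?thesis
  proof (cases "x = \<zero>")
    case True
    then show ?thesis using pos by (simp add: nat_pow_zero)
  next
    case False
    interpret M: group "(Multiplicative_Group.mult_of R)\<lparr>carrier := S - {\<zero>}\<rparr>"
      using subgroup_mult_of[OF F] field_mult_group by (rule subgroup.subgroup_is_group)
    have "x [^]\<^bsub>(Multiplicative_Group.mult_of R)\<lparr>carrier := S - {\<zero>}\<rparr>\<^esub> order ((Multiplicative_Group.mult_of R)\<lparr>carrier := S - {\<zero>}\<rparr>) = \<one>"
      using M.pow_order_eq_1[of x] x False by simp
    then have "x [^] (card S - 1) = \<one>"
      using monoid.nat_pow_consistent[of "Multiplicative_Group.mult_of R" x "card S - 1" "S - {\<zero>}"] fin zero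
        group.is_monoid[OF field_mult_group]
      by (simp add: order_def Multiplicative_Group.nat_pow_mult_of)
    then have "x [^] Suc (card S - 1) = x" using xR by simp
    then show ?thesis using pos by simp
  qed
qed

text \<open>
  Lagrange's theorem for the additive group. Applied to the unit of the prime field it yields the
  characteristic.
\<close>
lemma (in ring) add_pow_card_subring:
  assumes "subring S R" and "finite S" and "x \<in> S"
  shows "[card S] \<cdot> x = \<zero>"
proof -
  have "subgroup S (add_monoid R)" using assms(1) subring.axioms(1) by blast
  then interpret A: group "(add_monoid R)\<lparr>carrier := S\<rparr>"
    using add.is_group by (rule subgroup.subgroup_is_group)
  have "x [^]\<^bsub>(add_monoid R)\<lparr>carrier := S\<rparr>\<^esub> order ((add_monoid R)\<lparr>carrier := S\<rparr>) = \<zero>"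
    using A.pow_order_eq_1[of x] assms(3) by simp
  then show ?thesis
    using monoid.nat_pow_consistent[OF group.is_monoid[OF add.is_group], of x "card S" S]
    by (simp add: order_def add_pow_def)
qed

lemma (in ring) subring_of_subring_iff:
  assumes E: "subring E R"
  shows "subring S (R\<lparr>carrier := E\<rparr>) \<longleftrightarrow> subring S R \<and> S \<subseteq> E"
proof -
  interpret E: ring "R\<lparr>carrier := E\<rparr>" by (rule subring_is_ring[OF E])
  have "subring S (R\<lparr>carrier := E\<rparr>) \<longleftrightarrow> subring S R" if "S \<subseteq> E"
    using that subringE(1)[OF E] E.subring_iff[of S] subring_iff[of S] by simp
  then show ?thesis using subringE(1)[of S "R\<lparr>carrier := E\<rparr>"] by auto
qed

section \<open>Finite subfields of the algebraic closure\<close>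

locale prime_closure = algebraic_closure L K for L (structure) and K +
  fixes p :: nat
  assumes prime_p: "Factorial_Ring.prime p" and card_K: "card K = p"
begin

lemma finite_K: "finite K"
  using card_K prime_gt_0_nat[OF prime_p] by (metis card.infinite less_irrefl)

lemma char_p: "[p] \<cdot> \<one> = \<zero>"
  using add_pow_card_subring[OF subfieldE(1)[OF subfield_axioms] finite_K, of \<one>] card_K
    subringE(3)[OF subfieldE(1)[OF subfield_axioms]] by simp

text \<open>
  The subfield of \<open>L\<close> of order \<open>p ^ n\<close>, for \<open>n > 0\<close>. Describing it by an equation makes its relation
  to other subrings a matter of computing with exponents. For \<open>n = 0\<close> the equation is void and the
  set is all of \<open>L\<close>, which is why the index is often required to be positive.
\<close>
definition fixed :: "nat \<Rightarrow> 'a set" where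
  "fixed n = {x \<in> carrier L. x [^] (p ^ n) = x}"

lemma fixed_mem: "x \<in> fixed n \<longleftrightarrow> x \<in> carrier L \<and> x [^] (p ^ n) = x"
  by (simp add: fixed_def)

lemma card_fixed: "n > 0 \<Longrightarrow> card (fixed n) = p ^ n"
  unfolding fixed_def by (rule card_frobenius_fixed[OF prime_p char_p])

lemma finite_fixed: "n > 0 \<Longrightarrow> finite (fixed n)"
  using card_fixed[of n] prime_gt_0_nat[OF prime_p]
  by (metis card.infinite less_irrefl zero_less_power)

lemma subring_fixed: "subring (fixed n) L"
proof (rule subringI)
  have q: "p ^ n > 0" using prime_gt_0_nat[OF prime_p] by simp
  show "\<ominus> x \<in> fixed n" if x: "x \<in> fixed n" for x
  proof -
    have xL: "x \<in> carrier L" and xq: "x [^] (p ^ n) = x" using x by (auto simp: fixed_mem)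
    have "(\<ominus> x) [^] (p ^ n) \<oplus> x [^] (p ^ n) = (\<ominus> x \<oplus> x) [^] (p ^ n)"
      using frobenius_power_add[OF prime_p char_p, of "\<ominus> x" x n] xL by simp
    also have "\<dots> = \<zero>" using xL q by (simp add: l_neg nat_pow_zero)
    finally have "(\<ominus> x) [^] (p ^ n) \<oplus> x = \<zero>" using xq by simp
    then have "(\<ominus> x) [^] (p ^ n) = \<ominus> x" using xL by (intro minus_equality[symmetric]) auto
    then show ?thesis using xL by (simp add: fixed_mem)
  qed
qed (auto simp: fixed_mem nat_pow_distrib frobenius_power_add[OF prime_p char_p])

text \<open>
  The order of a finite subring is a power \<open>p ^ m\<close>, because its additive group has exponent \<open>p\<close>. By
  Lagrange all its elements satisfy \<open>x ^ (p ^ m) = x\<close>, and this equation has only \<open>p ^ m\<close>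
  solutions.
\<close>
lemma finite_subring_eq_fixed:
  assumes S: "subring S L" and fin: "finite S"
  shows "\<exists>m>0. S = fixed m"
proof -
  have "subgroup S (add_monoid L)" using S subring.axioms(1) by blast
  then interpret A: group "(add_monoid L)\<lparr>carrier := S\<rparr>"
    using add.is_group by (rule subgroup.subgroup_is_group)
  have "\<exists>m. order ((add_monoid L)\<lparr>carrier := S\<rparr>) = p ^ m"
  proof (rule A.order_prime_power_if_exponent_prime[OF _ prime_p])
    fix x assume x: "x \<in> carrier ((add_monoid L)\<lparr>carrier := S\<rparr>)"
    then have "x \<in> carrier L" using subringE(1)[OF S] by auto
    then have "[p] \<cdot> x = \<zero>" by (rule add_pow_eq_zero_of_dvd[OF char_p dvd_refl])
    then show "x [^]\<^bsub>(add_monoid L)\<lparr>carrier := S\<rparr>\<^esub> p = \<one>\<^bsub>(add_monoid L)\<lparr>carrier := S\<rparr>\<^esub>"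
      using monoid.nat_pow_consistent[OF group.is_monoid[OF add.is_group], of x p S]
      by (simp add: add_pow_def)
  qed (use fin in simp)
  then obtain m where m: "card S = p ^ m" by (auto simp: order_def)
  \<comment> \<open>The exponent is positive because a subring has at least two elements.\<close>
  have "card {\<zero>, \<one>} \<le> card S"
    using fin subringE(2,3)[OF S] by (intro card_mono) auto
  then have "m > 0" using m by (cases m) auto
  have "S \<subseteq> fixed m"
    using finite_subring_pow_card[OF S fin] subringE(1)[OF S] m by (auto simp: fixed_mem)
  then have "S = fixed m"
    using card_subset_eq[OF finite_fixed[OF \<open>m > 0\<close>]] card_fixed[OF \<open>m > 0\<close>] m by simp
  then show ?thesis using \<open>m > 0\<close> by blast
qed

text \<open>
  An element algebraic over \<open>K\<close> generates a finite-dimensional, hence finite, extension of \<open>K\<close>.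
\<close>
lemma mem_some_fixed:
  assumes x: "x \<in> carrier L"
  shows "\<exists>n>0. x \<in> fixed n"
proof -
  have K: "subfield K L" by (rule subfield_axioms)
  let ?S = "simple_extension K x"
  let ?Us = "exp_base x (degree (Irr K x))"
  have Us: "set ?Us \<subseteq> carrier L" by (rule exp_base_closed[OF x])
  have "?S = {combine Ks ?Us | Ks. length Ks = length ?Us \<and> set Ks \<subseteq> K}"
    using Span_exp_base[OF K x algebraic_extension[OF x]] Span_eq_combine_set_length_version[OF K Us]
    by simp
  also have "\<dots> = (\<lambda>Ks. combine Ks ?Us) ` {Ks. set Ks \<subseteq> K \<and> length Ks = length ?Us}"
    by auto
  finally have "finite ?S" using finite_lists_length_eq[OF finite_K] by simp
  moreover have "subring ?S L" "x \<in> ?S"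
    using simple_extension_is_subring[OF subfieldE(1)[OF K] x]
      simple_extension_mem[OF subfieldE(1)[OF K] x] by auto
  ultimately show ?thesis using finite_subring_eq_fixed by metis
qed


lemma fixed_add_iff:
  assumes "x \<in> fixed m"
  shows "x \<in> fixed (m + n) \<longleftrightarrow> x \<in> fixed n"
proof -
  have x: "x \<in> carrier L" "x [^] (p ^ m) = x" using assms by (auto simp: fixed_mem)
  have "x [^] (p ^ (m + n)) = (x [^] (p ^ m)) [^] (p ^ n)"
    using x(1) by (simp add: nat_pow_pow power_add)
  then show ?thesis using x by (simp add: fixed_mem)
qed

lemma fixed_mono_dvd:
  assumes "m dvd n" shows "fixed m \<subseteq> fixed n"
proof
  fix x assume x: "x \<in> fixed m"
  have "x \<in> fixed (m * k)" for k
    using x by (induction k) (auto simp: fixed_add_iff, simp add: fixed_mem)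
  then show "x \<in> fixed n" using assms by auto
qed

text \<open>
  If two powers of the Frobenius map fix \<open>x\<close>, so does the power whose exponent is their gcd, by a
  Bezout relation between the exponents.
\<close>
lemma fixed_inter: 
  assumes m: "m > 0" shows "fixed m \<inter> fixed n = fixed (gcd m n)"
proof
  show "fixed (gcd m n) \<subseteq> fixed m \<inter> fixed n"
    using fixed_mono_dvd[of "gcd m n"] by simp
  show "fixed m \<inter> fixed n \<subseteq> fixed (gcd m n)"
  proof
    fix x assume x: "x \<in> fixed m \<inter> fixed n"
    obtain a b where ab: "m * a = n * b + gcd m n"
      using bezout_nat[of m n] m by auto
    have "x \<in> fixed (n * b)" using x fixed_mono_dvd[of n "n * b"] by auto
    moreover have "x \<in> fixed (m * a)" using x fixed_mono_dvd[of m "m * a"] by auto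
    ultimately have "x \<in> fixed (n * b)" "x \<in> fixed (n * b + gcd m n)" unfolding ab .
    then show "x \<in> fixed (gcd m n)" using fixed_add_iff by blast
  qed
qed

text \<open>
  If \<open>fixed m \<subseteq> fixed n\<close>, then \<open>fixed m = fixed (gcd m n)\<close>, and comparing cardinalities gives
  \<open>m = gcd m n\<close>.
\<close>
lemma fixed_subset_iff:
  assumes m: "m > 0" and n: "n > 0"
  shows "fixed m \<subseteq> fixed n \<longleftrightarrow> m dvd n"
proof
  assume "fixed m \<subseteq> fixed n"
  then have "fixed m = fixed (gcd m n)" using fixed_inter[OF m, of n] by auto
  moreover have "gcd m n > 0" using m by simp
  ultimately have "p ^ m = p ^ gcd m n" using card_fixed[OF m] card_fixed by simp
  then have "m = gcd m n" using power_inject_exp[OF prime_gt_1_nat[OF prime_p]] by blast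
  then show "m dvd n" by (metis gcd_dvd2)
qed (rule fixed_mono_dvd)

text \<open>
  The key fact: seen from a finite subfield, an arbitrary subring is again one of the finite
  subfields. All later statements about subrings reduce to divisibility through it.
\<close>
lemma subring_inter_fixed:
  assumes S: "subring S L" and n: "n > 0"
  obtains m where "m > 0" "m dvd n" "S \<inter> fixed n = fixed m"
proof -
  have "subring (S \<inter> fixed n) L" by (rule subring_inter[OF S subring_fixed])
  then obtain m where m: "m > 0" "S \<inter> fixed n = fixed m"
    using finite_subring_eq_fixed finite_fixed[OF n] by blast
  then show thesis using that fixed_subset_iff[OF m(1) n] by blast
qed

lemma mem_subring_fixed:
  assumes S: "subring S L" and x: "x \<in> S"
  obtains m where "m > 0" "x \<in> fixed m" "fixed m \<subseteq> S"
proof -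
  have "x \<in> carrier L" using x subringE(1)[OF S] by auto
  then obtain n where n: "n > 0" "x \<in> fixed n" using mem_some_fixed by blast
  obtain m where "m > 0" "S \<inter> fixed n = fixed m" using subring_inter_fixed[OF S n(1)] by blast
  then show thesis using that x n(2) by blast
qed

text \<open>
  Finite subfields are generated by their subfields of prime power degree. Indeed \<open>S \<inter> fixed m\<close> is
  \<open>fixed d\<close>, and \<open>d\<close> is divisible by every prime power that divides \<open>m\<close>.
\<close>
lemma fixed_subset_if_prime_powers:
  assumes S: "subring S L" and m: "m > 0"
    and pp: "\<And>q k. \<lbrakk>Factorial_Ring.prime q; q ^ k dvd m\<rbrakk> \<Longrightarrow> fixed (q ^ k) \<subseteq> S"
  shows "fixed m \<subseteq> S"
proof -
  obtain d where d: "d > 0" "d dvd m" "S \<inter> fixed m = fixed d"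
    using subring_inter_fixed[OF S m] by blast
  have "m dvd d"
  proof (rule multiplicity_le_imp_dvd)
    show "m \<noteq> 0" using m by simp
    fix q :: nat assume q: "Factorial_Ring.prime q"
    let ?k = "multiplicity q m"
    have k: "q ^ ?k dvd m" by (rule multiplicity_dvd)
    then have "fixed (q ^ ?k) \<subseteq> fixed d"
      using pp[OF q k] fixed_mono_dvd[OF k] d(3) by auto
    then have "q ^ ?k dvd d" using fixed_subset_iff d(1) prime_gt_0_nat[OF q] by simp
    then show "?k \<le> multiplicity q d"
      using d(1) q by (intro multiplicity_geI) (auto simp: prime_gt_1_nat)
  qed
  then show ?thesis using fixed_mono_dvd d(3) by blast
qed

lemma GF_eq_fixed:
  assumes n: "n > 0" shows "GF L (p ^ n) = fixed n"
  unfolding GF_def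
proof (rule the_equality)
  show "subfield (fixed n) L \<and> card (fixed n) = p ^ n"
    using finite_subring_is_subfield[OF subring_fixed finite_fixed[OF n]] card_fixed[OF n] by simp
  fix F assume F: "subfield F L \<and> card F = p ^ n"
  have "finite F" using F prime_gt_0_nat[OF prime_p] by (metis card.infinite less_irrefl zero_less_power)
  then obtain m where m: "m > 0" "F = fixed m"
    using finite_subring_eq_fixed F subfieldE(1) by blast
  then have "p ^ m = p ^ n" using F card_fixed by simp
  then have "m = n" using power_inject_exp[OF prime_gt_1_nat[OF prime_p]] by blast
  then show "F = fixed n" using m(2) by simp
qed

lemma FG_eq: "FG L p E = {n. n > 0 \<and> fixed n \<subseteq> E}"
  unfolding FG_def using GF_eq_fixed by auto

lemma K_eq_fixed: "K = fixed 1"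
proof -
  obtain m where m: "m > 0" "K = fixed m"
    using finite_subring_eq_fixed[OF subfieldE(1)[OF subfield_axioms] finite_K] by blast
  then have "p ^ m = p ^ 1" using card_K card_fixed by simp
  then have "m = 1" using power_inject_exp[OF prime_gt_1_nat[OF prime_p]] by blast
  then show ?thesis using m(2) by simp
qed

lemma fixed_1_subset:
  assumes "subring S L" shows "fixed 1 \<subseteq> S"
proof -
  obtain m where "m > 0" "m dvd 1" "S \<inter> fixed 1 = fixed m"
    using subring_inter_fixed[OF assms, of 1] by auto
  then show ?thesis by auto
qed

section \<open>Bounding the exponent of one prime in the degree\<close>

text \<open>
  The elements of \<open>L\<close> whose degree over \<open>K\<close> is not divisible by \<open>q ^ k\<close>. The union over all finite
  subfields with this property avoids speaking about minimal polynomials.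
\<close>
definition avoiding :: "nat \<Rightarrow> nat \<Rightarrow> 'a set" where
  "avoiding q k = (\<Union>n \<in> {n. n > 0 \<and> \<not> q ^ k dvd n}. fixed n)"

text \<open>
  A prime power that divides a least common multiple divides one of the two numbers. So any two
  elements of \<open>avoiding q k\<close> lie in a common finite subfield whose degree is not divisible by
  \<open>q ^ k\<close>.
\<close>
lemma subring_avoiding:
  assumes q: "Factorial_Ring.prime q" and k: "k > 0"
  shows "subring (avoiding q k) L"
proof -
  have no1: "\<not> q ^ k dvd 1" using prime_gt_1_nat[OF q] k by auto
  have common: "\<exists>n>0. \<not> q ^ k dvd n \<and> x \<in> fixed n \<and> y \<in> fixed n"
    if xy: "x \<in> avoiding q k" "y \<in> avoiding q k" for x y
  proof -
    obtain m n where m: "m > 0" "\<not> q ^ k dvd m" "x \<in> fixed m"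
      and n: "n > 0" "\<not> q ^ k dvd n" "y \<in> fixed n"
      using xy by (auto simp: avoiding_def)
    have "lcm m n > 0" using m n by (simp add: lcm_pos_nat)
    moreover have "\<not> q ^ k dvd lcm m n"
    proof -
      have "multiplicity q (lcm m n) = max (multiplicity q m) (multiplicity q n)"
        using m(1) n(1) q by (intro multiplicity_lcm) auto
      moreover have "multiplicity q m < k" "multiplicity q n < k"
        using m(2) n(2) multiplicity_dvd'[of k q] not_le by blast+
      ultimately have "multiplicity q (lcm m n) < k" by simp
      moreover have "lcm m n \<noteq> 0" "\<not> is_unit q"
        using m(1) n(1) prime_gt_1_nat[OF q] by auto
      ultimately show ?thesis using multiplicity_geI by (metis not_le)
    qed
    moreover have "x \<in> fixed (lcm m n)" "y \<in> fixed (lcm m n)"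
      using fixed_mono_dvd[of m "lcm m n"] fixed_mono_dvd[of n "lcm m n"] m(3) n(3) by auto
    ultimately show ?thesis by blast
  qed
  have in_av: "z \<in> avoiding q k" if "n > 0" "\<not> q ^ k dvd n" "z \<in> fixed n" for z n
    using that by (auto simp: avoiding_def)
  show ?thesis
  proof (rule subringI)
    show "avoiding q k \<subseteq> carrier L" by (auto simp: avoiding_def fixed_mem)
    show "\<one> \<in> avoiding q k" using in_av[of 1] no1 subringE(3)[OF subring_fixed] by auto
    show "\<ominus> x \<in> avoiding q k" if "x \<in> avoiding q k" for x
      using common[OF that that] in_av subringE(5)[OF subring_fixed] by blast
    show "x \<otimes> y \<in> avoiding q k" if "x \<in> avoiding q k" "y \<in> avoiding q k" for x y
      using common[OF that] in_av subringE(6)[OF subring_fixed] by blast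
    show "x \<oplus> y \<in> avoiding q k" if "x \<in> avoiding q k" "y \<in> avoiding q k" for x y
      using common[OF that] in_av subringE(7)[OF subring_fixed] by blast
  qed
qed

text \<open>
  If \<open>fixed (q ^ k)\<close> were contained in \<open>avoiding q k\<close>, each of its elements would lie in a proper
  subfield of it. All of these are contained in the single proper subfield \<open>fixed (q ^ (k - 1))\<close>,
  because the divisors of a prime power form a chain.
\<close>
lemma fixed_subset_avoiding_iff:
  assumes q: "Factorial_Ring.prime q" and k: "k > 0" and n: "n > 0"
  shows "fixed n \<subseteq> avoiding q k \<longleftrightarrow> \<not> q ^ k dvd n"
proof
  assume sub: "fixed n \<subseteq> avoiding q k"
  show "\<not> q ^ k dvd n"
  proof
    assume dvd: "q ^ k dvd n"
    have pos: "q ^ j > 0" for j using prime_gt_0_nat[OF q] by simp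
    have "fixed (q ^ k) \<subseteq> fixed (q ^ (k - 1))"
    proof
      fix x assume x: "x \<in> fixed (q ^ k)"
      then obtain m where m: "\<not> q ^ k dvd m" "x \<in> fixed m"
        using sub fixed_mono_dvd[OF dvd] by (auto simp: avoiding_def)
      have "x \<in> fixed (gcd (q ^ k) m)" using fixed_inter[OF pos] x m(2) by blast
      moreover obtain i where i: "i \<le> k" "gcd (q ^ k) m = q ^ i"
        using divides_primepow_nat[OF q] gcd_dvd1[of "q ^ k" m] by blast
      moreover have "i \<noteq> k" using m(1) i(2) by (metis gcd_dvd2)
      ultimately show "x \<in> fixed (q ^ (k - 1))"
        using fixed_mono_dvd[of "q ^ i" "q ^ (k - 1)"] le_imp_power_dvd[of i "k - 1" q] by auto
    qed
    then have "q ^ k dvd q ^ (k - 1)" using fixed_subset_iff[OF pos pos] by simp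
    then show False using k prime_gt_1_nat[OF q] by (simp add: dvd_power_iff_le)
  qed
qed (use n in \<open>auto simp: avoiding_def\<close>)

lemma subset_avoiding:
  assumes S: "subring S L" and not: "\<not> fixed (q ^ k) \<subseteq> S"
  shows "S \<subseteq> avoiding q k"
proof
  fix x assume x: "x \<in> S"
  obtain m where m: "m > 0" "x \<in> fixed m" "fixed m \<subseteq> S" using mem_subring_fixed[OF S x] .
  have "\<not> q ^ k dvd m" using fixed_mono_dvd m(3) not by blast
  then show "x \<in> avoiding q k" using m by (auto simp: avoiding_def)
qed

text \<open>
  A subring of \<open>E\<close> is determined by the \<open>fixed (r ^ k)\<close> with \<open>r\<close> prime that it contains. For \<open>r \<noteq> q\<close>
  these lie in \<open>avoiding q 1\<close>, so only the powers of \<open>q\<close> are left to compare.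
\<close>
lemma eq_if_avoiding_subset:
  assumes E: "subring E L" and S: "subring S L" "S \<subseteq> E"
    and q: "Factorial_Ring.prime q"
    and top: "\<And>j. fixed (q ^ j) \<subseteq> E \<Longrightarrow> fixed (q ^ j) \<subseteq> S"
    and av: "E \<inter> avoiding q 1 \<subseteq> S"
  shows "S = E"
proof
  show "E \<subseteq> S"
  proof
    fix z assume z: "z \<in> E"
    obtain m where m: "m > 0" "z \<in> fixed m" "fixed m \<subseteq> E" using mem_subring_fixed[OF E z] .
    have "fixed m \<subseteq> S"
    proof (rule fixed_subset_if_prime_powers[OF S(1) m(1)])
      fix r k assume r: "Factorial_Ring.prime r" "r ^ k dvd m"
      have rE: "fixed (r ^ k) \<subseteq> E" using fixed_mono_dvd[OF r(2)] m(3) by blast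
      show "fixed (r ^ k) \<subseteq> S"
      proof (cases "r = q")
        case True then show ?thesis using top rE by blast
      next
        case False
        then have "\<not> q ^ 1 dvd r ^ k"
          using q r(1) by (metis power_one_right prime_dvd_power primes_dvd_imp_eq)
        then have "fixed (r ^ k) \<subseteq> avoiding q 1"
          using fixed_subset_avoiding_iff[OF q] prime_gt_0_nat[OF r(1)] by simp
        then show ?thesis using av rE by blast
      qed
    qed
    then show "z \<in> S" using m(2) by blast
  qed
qed (rule S(2))

lemma avoiding_mono: "j \<le> k \<Longrightarrow> avoiding q j \<subseteq> avoiding q k"
  unfolding avoiding_def using le_imp_power_dvd dvd_trans by blast

section \<open>Maximal subrings of an absolutely algebraic field\<close>

text \<open>
  The hypotheses say that \<open>q ^ k\<close> is the largest power of \<open>q\<close> among the degrees of finite subfields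
  of \<open>E\<close>. A subring strictly above \<open>E \<inter> avoiding q k\<close> must contain \<open>fixed (q ^ k)\<close>, hence all
  subfields of \<open>E\<close> of \<open>q\<close>-power degree, hence everything.
\<close>
lemma maximal_subring_avoiding:
  assumes E: "subring E L" and q: "Factorial_Ring.prime q" and k: "k > 0"
    and in_E: "fixed (q ^ k) \<subseteq> E" and out: "\<not> fixed (q ^ Suc k) \<subseteq> E"
  shows "maximal_subring (E \<inter> avoiding q k) (L\<lparr>carrier := E\<rparr>)"
proof -
  let ?M = "E \<inter> avoiding q k"
  have pos: "q ^ j > 0" for j using prime_gt_0_nat[OF q] by simp
  have M: "subring ?M L" by (rule subring_inter[OF E subring_avoiding[OF q k]])
  have "?M \<noteq> E" using fixed_subset_avoiding_iff[OF q k pos, of k] in_E by auto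
  moreover have "S = ?M" if S: "subring S L" "S \<subseteq> E" "S \<noteq> E" "?M \<subseteq> S" for S
  proof (rule ccontr)
    assume "S \<noteq> ?M"
    then obtain y where y: "y \<in> S" "y \<notin> avoiding q k" using S by blast
    then have top: "fixed (q ^ k) \<subseteq> S" using subset_avoiding[OF S(1)] by blast
    have "S = E"
    proof (rule eq_if_avoiding_subset[OF E S(1,2) q])
      show "E \<inter> avoiding q 1 \<subseteq> S" using avoiding_mono[of 1 k q] k S(4) by auto
      fix j assume j: "fixed (q ^ j) \<subseteq> E"
      have "j \<le> k"
      proof (rule ccontr)
        assume "\<not> j \<le> k"
        then have "q ^ Suc k dvd q ^ j" by (intro le_imp_power_dvd) simp
        then show False using fixed_mono_dvd j out by blast
      qed
      then show "fixed (q ^ j) \<subseteq> S" using fixed_mono_dvd[OF le_imp_power_dvd] top by blast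
    qed
    then show False using S(3) by simp
  qed
  ultimately show ?thesis
    using M by (auto simp: maximal_subring_def subring_of_subring_iff[OF E])
qed

text \<open>
  A proper subring \<open>S\<close> misses some \<open>fixed (q ^ j)\<close> inside \<open>E\<close>; since the powers of \<open>q\<close> occurring in
  \<open>E\<close> are bounded, the largest one gives a maximal subring that contains \<open>S\<close>.
\<close>
lemma exists_maximal_subring:
  assumes E: "subring E L" and fin: "infinite_primes (FG L p E) = {}"
    and S: "subring S L" "S \<subseteq> E" "S \<noteq> E"
  shows "\<exists>M. maximal_subring M (L\<lparr>carrier := E\<rparr>) \<and> S \<subseteq> M"
proof -
  obtain z where z: "z \<in> E" "z \<notin> S" using S by blast
  obtain m where m: "m > 0" "z \<in> fixed m" "fixed m \<subseteq> E" using mem_subring_fixed[OF E z(1)] .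
  then have "\<not> fixed m \<subseteq> S" using z(2) by blast
  then obtain q j where q: "Factorial_Ring.prime q" "q ^ j dvd m" "\<not> fixed (q ^ j) \<subseteq> S"
    using fixed_subset_if_prime_powers[OF S(1) m(1)] by blast
  have jE: "fixed (q ^ j) \<subseteq> E" using fixed_mono_dvd[OF q(2)] m(3) by blast
  have j0: "j > 0" using q(3) fixed_1_subset[OF S(1)] by (cases j) auto
  have "q \<notin> infinite_primes (FG L p E)" using fin by simp
  then obtain b where "b > 0" "q ^ b \<notin> FG L p E" using q(1) by (auto simp: infinite_primes_def)
  then have b: "\<not> fixed (q ^ b) \<subseteq> E" using prime_gt_0_nat[OF q(1)] by (simp add: FG_eq)
  have down: "fixed (q ^ i) \<subseteq> fixed (q ^ k)" if "i \<le> k" for i k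
    using that by (intro fixed_mono_dvd le_imp_power_dvd)
  define k where "k = (GREATEST i. fixed (q ^ i) \<subseteq> E)"
  have bound: "i \<le> b" if "fixed (q ^ i) \<subseteq> E" for i
    using that b down[of b i] by (meson nle_le subset_trans)
  have kE: "fixed (q ^ k) \<subseteq> E"
    unfolding k_def by (rule GreatestI_nat[of _ j b]) (use jE bound in auto)
  have kmax: "i \<le> k" if "fixed (q ^ i) \<subseteq> E" for i
    unfolding k_def by (rule Greatest_le_nat[of _ i b]) (use that bound in auto)
  have "j \<le> k" by (rule kmax[OF jE])
  then have "\<not> fixed (q ^ k) \<subseteq> S" using q(3) down by blast
  then have "S \<subseteq> E \<inter> avoiding q k" using subset_avoiding[OF S(1)] S(2) by blast
  moreover have "\<not> fixed (q ^ Suc k) \<subseteq> E" using kmax[of "Suc k"] by auto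
  ultimately show ?thesis
    using maximal_subring_avoiding[OF E q(1) _ kE] j0 \<open>j \<le> k\<close> by (meson less_le_trans)
qed

text \<open>
  Above \<open>E \<inter> avoiding q 1\<close> the subrings form the strictly increasing chain of the \<open>E \<inter> avoiding q k\<close>,
  followed by \<open>E\<close> itself, so a proper one among them can always be enlarged to another proper one.
\<close>
lemma no_maximal_subring_above_avoiding:
  assumes E: "subring E L" and q: "q \<in> infinite_primes (FG L p E)"
    and M: "maximal_subring M (L\<lparr>carrier := E\<rparr>)"
  shows "\<not> E \<inter> avoiding q 1 \<subseteq> M"
proof
  assume above: "E \<inter> avoiding q 1 \<subseteq> M"
  have qp: "Factorial_Ring.prime q" using q by (simp add: infinite_primes_def)
  have pos: "q ^ j > 0" for j using prime_gt_0_nat[OF qp] by simp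
  have qE: "fixed (q ^ j) \<subseteq> E" for j
    using q fixed_1_subset[OF E] by (cases "j = 0") (auto simp: infinite_primes_def FG_eq)
  have MS: "subring M L" "M \<subseteq> E" "M \<noteq> E"
    and max: "\<And>S. \<lbrakk>subring S L; S \<subseteq> E; S \<noteq> E; M \<subseteq> S\<rbrakk> \<Longrightarrow> S = M"
    using M by (auto simp: maximal_subring_def subring_of_subring_iff[OF E])
  obtain j where j: "\<not> fixed (q ^ j) \<subseteq> M"
    using eq_if_avoiding_subset[OF E MS(1,2) qp _ above] MS(3) by blast
  define k where "k = (LEAST j. \<not> fixed (q ^ j) \<subseteq> M)"
  have k: "\<not> fixed (q ^ k) \<subseteq> M" unfolding k_def using j by (rule LeastI)
  have "E \<inter> avoiding q (Suc k) = M"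
  proof (rule max)
    show "subring (E \<inter> avoiding q (Suc k)) L"
      by (intro subring_inter E subring_avoiding qp) simp
    show "E \<inter> avoiding q (Suc k) \<noteq> E"
      using fixed_subset_avoiding_iff[OF qp _ pos, of "Suc k" "Suc k"] qE[of "Suc k"] by auto
    show "M \<subseteq> E \<inter> avoiding q (Suc k)"
      using subset_avoiding[OF MS(1) k] avoiding_mono[of k "Suc k" q] MS(2) by auto
  qed auto
  moreover have "fixed (q ^ k) \<subseteq> avoiding q (Suc k)"
    using fixed_subset_avoiding_iff[OF qp _ pos, of "Suc k" k] prime_gt_1_nat[OF qp]
    by (simp add: dvd_power_iff_le)
  ultimately show False using k qE[of k] by blast
qed

lemma all_extend_iff:
  assumes E: "subring E L"
  shows "(\<forall>S. subring S (L\<lparr>carrier := E\<rparr>) \<and> S \<noteq> E \<longrightarrow>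
            (\<exists>M. maximal_subring M (L\<lparr>carrier := E\<rparr>) \<and> S \<subseteq> M))
          \<longleftrightarrow> infinite_primes (FG L p E) = {}" (is "?A \<longleftrightarrow> ?B")
proof
  assume A: ?A
  show ?B
  proof (rule ccontr)
    assume "\<not> ?B"
    then obtain q where q: "q \<in> infinite_primes (FG L p E)" by blast
    have qp: "Factorial_Ring.prime q" using q by (simp add: infinite_primes_def)
    have "q ^ n \<in> FG L p E" if "n > 0" for n using q that by (simp add: infinite_primes_def)
    from this[of 1] have "fixed q \<subseteq> E" by (simp add: FG_eq)
    moreover have "\<not> fixed q \<subseteq> avoiding q 1"
      using fixed_subset_avoiding_iff[OF qp, of 1 q] prime_gt_0_nat[OF qp] by simp
    ultimately have "E \<inter> avoiding q 1 \<noteq> E" by blast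
    moreover have "subring (E \<inter> avoiding q 1) (L\<lparr>carrier := E\<rparr>)"
      using subring_inter[OF E subring_avoiding[OF qp, of 1]] subring_of_subring_iff[OF E] by simp
    ultimately show False using A no_maximal_subring_above_avoiding[OF E q] by blast
  qed
next
  assume ?B then show ?A
    using exists_maximal_subring[OF E] subring_of_subring_iff[OF E] by blast
qed

text \<open>
  Without infinite primes the index set of the union is \<open>{1}\<close>; an infinite prime \<open>q\<close> puts the field
  of order \<open>p ^ q\<close> into the union, which is too large for \<open>K\<close>.
\<close>
lemma infinite_part_eq_K_iff:
  "infinite_part L p E = K \<longleftrightarrow> infinite_primes (FG L p E) = {}"
proof
  assume none: "infinite_primes (FG L p E) = {}"
  have "{n. n > 0 \<and> (\<forall>q. Factorial_Ring.prime q \<and> q dvd n \<longrightarrow> q \<in> infinite_primes (FG L p E))} = {1}"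
    unfolding none using prime_factor_nat by auto
  then have "infinite_part L p E = GF L (p ^ 1)"
    unfolding infinite_part_def by simp
  then show "infinite_part L p E = K" using GF_eq_fixed[of 1] K_eq_fixed by simp
next
  assume eq: "infinite_part L p E = K"
  show "infinite_primes (FG L p E) = {}"
  proof (rule ccontr)
    assume "infinite_primes (FG L p E) \<noteq> {}"
    then obtain q where q: "q \<in> infinite_primes (FG L p E)" by blast
    then have qp: "Factorial_Ring.prime q" by (simp add: infinite_primes_def)
    have q0: "q > 0" by (rule prime_gt_0_nat[OF qp])
    have "GF L (p ^ q) \<subseteq> infinite_part L p E"
      unfolding infinite_part_def using q q0 qp by (auto dest: primes_dvd_imp_eq)
    then have "fixed q \<subseteq> fixed 1" using GF_eq_fixed[OF q0] eq K_eq_fixed by simp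
    then show False using fixed_subset_iff[OF q0, of 1] prime_gt_1_nat[OF qp] by simp
  qed
qed

end

text \<open>
  Purely about exponents: the first power of \<open>q\<close> outside \<open>T\<close> is preceded by one inside \<open>T\<close>, provided
  that \<open>q\<close> itself lies in \<open>T\<close>. Primes outside \<open>T\<close> are never infinite.
\<close>
lemma infinite_primes_empty_iff:
  "infinite_primes T = {} \<longleftrightarrow> (\<forall>q\<in>T. Factorial_Ring.prime q \<longrightarrow> has_finite_order_in q T)"
proof
  assume none: "infinite_primes T = {}"
  show "\<forall>q\<in>T. Factorial_Ring.prime q \<longrightarrow> has_finite_order_in q T"
  proof (intro ballI impI)
    fix q assume q: "q \<in> T" "Factorial_Ring.prime q"
    obtain b where "b > 0" "q ^ b \<notin> T" using none q(2) by (auto simp: infinite_primes_def)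
    \<comment> \<open>Shifting the exponent by one keeps it positive under the least-number principle.\<close>
    define P where "P = (\<lambda>i. q ^ Suc i \<notin> T)"
    have "P (b - 1)" using \<open>b > 0\<close> \<open>q ^ b \<notin> T\<close> by (simp add: P_def del: power_Suc)
    then have least: "P (LEAST i. P i)" by (rule LeastI)
    moreover have "\<not> P 0" using q(1) by (simp add: P_def)
    ultimately obtain i where i: "(LEAST i. P i) = Suc i" by (cases "LEAST i. P i") auto
    then have "\<not> P i" using not_less_Least[of i P] by simp
    then show "has_finite_order_in q T"
      using least i by (auto simp: has_finite_order_in_def P_def intro!: exI[of _ "Suc i"])
  qed
next
  assume fin: "\<forall>q\<in>T. Factorial_Ring.prime q \<longrightarrow> has_finite_order_in q T"
  show "infinite_primes T = {}"
  proof (rule ccontr)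
    assume "infinite_primes T \<noteq> {}"
    then obtain q where q: "Factorial_Ring.prime q" "\<And>n. n > 0 \<Longrightarrow> q ^ n \<in> T"
      unfolding infinite_primes_def by blast
    have "q \<in> T" using q(2)[of 1] by simp
    then obtain n where "q ^ (n + 1) \<notin> T"
      using fin q(1) by (auto simp: has_finite_order_in_def)
    then show False using q(2)[of "n + 1"] by simp
  qed
qed

theorem proposition1p14:
  fixes \<Omega> :: "('a, 'b) ring_scheme" and Fp E :: "'a set" and p :: nat and T :: "nat set"
  assumes "Factorial_Ring.prime p"
    and "algebraic_closure \<Omega> Fp" and "card Fp = p"
    and "subfield E \<Omega>"
    and "T = FG \<Omega> p E"
  shows "((\<forall>S. subring S (\<Omega>\<lparr>carrier := E\<rparr>) \<and> S \<noteq> E \<longrightarrow>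
            (\<exists>M. maximal_subring M (\<Omega>\<lparr>carrier := E\<rparr>) \<and> S \<subseteq> M))
          \<longleftrightarrow> infinite_primes T = {})
       \<and> (infinite_primes T = {} \<longleftrightarrow>
            (\<forall>q\<in>T. Factorial_Ring.prime q \<longrightarrow> has_finite_order_in q T))
       \<and> (infinite_primes T = {} \<longleftrightarrow> infinite_part \<Omega> p E = Fp)"
proof -
  interpret prime_closure \<Omega> Fp p
    using assms(1-3) by (simp add: prime_closure_def prime_closure_axioms_def)
  show ?thesis
    unfolding assms(5)
    by (intro conjI all_extend_iff infinite_primes_empty_iff infinite_part_eq_K_iff[symmetric]
        subfieldE(1)[OF assms(4)])
qed

end
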